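(* Let $X$ be a real Banach space, let $G\subset\mathbb{R}^m$ be a subset with $G^{o}\neq\emptyset$ and $|G\setminus G^{o}|=0$, let $f:G\to X$ be a function and let $F:\mathcal{I}_G\to X$ be an additive interval function. Let $h:\mathbb{R}^m\to X$ be defined by $h(t)=f(t)$ if $t\in G$ and $h(t)=0$ if $t\in\mathbb{R}^m\setminus G$. Then the following statements are equivalent: (i) $f$ is Hake-Henstock-Kurzweil integrable on $G$ with the primitive $F$; (ii) $h$ is locally Henstock-Kurzweil integrable on $\mathbb{R}^m$ with a primitive $H:\mathcal{I}\to X$ such that $H(I)=F(I)$ for all $I\in\mathcal{I}_G$, and $$H(I)=\sum_{k:\,|I\cap C_k|>0}F(I\cap C_k),\quad\text{for all } I\in\mathcal{I},$$ whenever $(C_k)\in\mathscr{D}_{G^{o}}$.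
   Context: $\|\cdot\|$ is the norm of $X$. $\mathbb{R}^m$ carries the maximum norm, and $B_m(t,r)$ is the open ball with center $t$ and radius $r>0$. $|A|$ is the Lebesgue measure of $A\subset\mathbb{R}^m$; $A^{o}$ is the interior of $A$. Intervals. A closed non-degenerate interval in $\mathbb{R}^m$ is a set $\prod_{j=1}^m[a_j,b_j]$ with $-\infty<a_j<b_j<+\infty$. $\mathcal{I}$ is the family of all of these (so $\mathcal{I}=\mathcal{I}_{\mathbb{R}^m}$), and for $E\subset\mathbb{R}^m$, $\mathcal{I}_E$ is the family of those contained in $E$. Two intervals $I,J$ are non-overlapping if $I^{o}\cap J^{o}=\emptyset$. A function $F:\mathcal{I}_E\to X$ is an additive interval function if $F(I\cup J)=F(I)+F(J)$ for all non-overlapping $I,J\in\mathcal{I}_E$ with $I\cup J\in\mathcal{I}_E$. Partitions. An $\mathcal{HK}$-tagged interval in $E$ is a pair $(t,I)$ with $I\in\mathcal{I}_E$ and $t\in I$. An $\mathcal{HK}$-partition in $E$ is a finite collection $\{(t_i,I_i)\}_{i=1}^p$ of $\mathcal{HK}$-tagged intervals in $E$ with the $I_i$ pairwise non-overlapping; it is a partition of $E$ if $\bigcup_i I_i=E$. A gauge on $Z$ is a function $\delta:Z\to(0,+\infty)$. A partition is $Z$-tagged if all $t_i\in Z$, and $\delta$-fine if $I_i\subset B_m(t_i,\delta(t_i))$ for all $i$. Henstock-Kurzweil integral. For $J\in\mathcal{I}$, $g:J\to X$ is Henstock-Kurzweil integrable on $J$ with integral $x\in X$ if for every $\varepsilon>0$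 there is a gauge $\delta$ on $J$ such that $\|\sum_{(t,I)\in\pi}g(t)|I|-x\|<\varepsilon$ for every $\delta$-fine $\mathcal{HK}$-partition $\pi$ of $J$. A Henstock-Kurzweil integrable $g$ is Henstock-Kurzweil integrable on every $I\in\mathcal{I}_J$, and its primitive is the additive interval function $I\mapsto (HK)\int_I g\,d\lambda$, $I\in\mathcal{I}_J$. Local integrability. For $W\subset\mathbb{R}^m$ open, $v:W\to X$ and an additive interval function $V:\mathcal{I}_W\to X$, $v$ is locally Henstock-Kurzweil integrable on $W$ with the primitive $V$ if for each $J\in\mathcal{I}_W$ the restriction $v|_J$ is Henstock-Kurzweil integrable on $J$ with the primitive $V|_{\mathcal{I}_J}$. Divisions. Let $E\subset\mathbb{R}^m$ with $|E\setminus E^{o}|=0$. A division of $E^{o}$ is a sequence $(I_k)_{k\ge1}$ of pairwise non-overlapping intervals in $\mathcal{I}_E$ with $E^{o}=\bigcup_{k=1}^{\infty}I_k$; $\mathscr{D}_{E^{o}}$ is the family of all divisions of $E^{o}$. Hake-function. An additive interval function $F:\mathcal{I}_E\to X$ is a Hake-function if for every division $(I_k)\in\mathscr{D}_{E^{o}}$: the series $\sum_{k:|I\cap I_k|>0}F(I\cap I_k)$ is unconditionally convergent in $X$ for each $I\in\mathcal{I}$, and $F(I)=\sum_{k:|I\cap I_k|>0}F(I\cap I_k)$ for all $I\in\mathcal{I}_E$. Negligible variation. An additive interval function $F:\mathcal{I}_E\to X$ has $\mathcal{HK}$-negligible variation over $Z\subset\mathbb{R}^m$ if for each $\varepsilon>0$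 there is a gauge $\delta_v$ on $Z$ such that for each $Z$-tagged $\delta_v$-fine $\mathcal{HK}$-partition $\pi_v$ in $\mathbb{R}^m$ and every $(I_k)\in\mathscr{D}_{E^{o}}$: the series $\sum_{k:|I\cap I_k|>0}F(I\cap I_k)$ is unconditionally convergent in $X$ for each $(t,I)\in\pi_v$, and $\left\|\sum_{(t,I)\in\pi_v}\left(\sum_{k:|I\cap I_k|>0}F(I\cap I_k)\right)\right\|<\varepsilon$. $F$ has $\mathcal{HK}$-negligible variation outside of $E^{o}$ if it has $\mathcal{HK}$-negligible variation over $\mathbb{R}^m\setminus E^{o}$. Hake-Henstock-Kurzweil integral. $f:E\to X$ is Hake-Henstock-Kurzweil integrable on $E$ with the primitive $F:\mathcal{I}_E\to X$ (an additive interval function) if: (a) for each $\varepsilon>0$ there is a gauge $\delta_\varepsilon$ on $E^{o}$ such that $\|\sum_{(t,I)\in\pi}(f(t)|I|-F(I))\|<\varepsilon$ for each $\delta_\varepsilon$-fine $\mathcal{HK}$-partition $\pi$ in $E^{o}$; (b) $F$ is a Hake-function; (c) $F$ has $\mathcal{HK}$-negligible variation outside of $E^{o}$. *)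

theory Defs
  imports "HOL-Analysis.Analysis"
begin

text \<open>
  \<open>\<real>\<^sup>m\<close> is \<^typ>\<open>real ^ 'n\<close> with \<open>m = CARD('n)\<close>. Its type-class norm is the Euclidean one, so balls of
  the maximum norm are formed with \<^const>\<open>infnorm\<close>. The Euclidean and the maximum norm give the
  same topology, hence \<^const>\<open>interior\<close> and \<^const>\<open>open\<close> need no adaptation.
\<close>

definition max_ball :: "real ^ 'n \<Rightarrow> real \<Rightarrow> (real ^ 'n) set" where
  "max_ball t r = {x. infnorm (x - t) < r}"

definition intervals_in :: "(real ^ 'n) set \<Rightarrow> (real ^ 'n) set set" where
  "intervals_in E = {cbox a b |a b. (\<forall>j. a $ j < b $ j) \<and> cbox a b \<subseteq> E}"

definition nonoverlapping :: "(real ^ 'n) set \<Rightarrow> (real ^ 'n) set \<Rightarrow> bool" where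
  "nonoverlapping I J \<longleftrightarrow> interior I \<inter> interior J = {}"

text \<open>
  An interval function on \<^term>\<open>intervals_in E\<close> is a total function on sets of which only the values
  on \<^term>\<open>intervals_in E\<close> are ever used.
\<close>

definition additive_interval_function ::
    "(real ^ 'n) set \<Rightarrow> ((real ^ 'n) set \<Rightarrow> 'x::real_normed_vector) \<Rightarrow> bool" where
  "additive_interval_function E F \<longleftrightarrow>
     (\<forall>I\<in>intervals_in E. \<forall>J\<in>intervals_in E.
        nonoverlapping I J \<and> I \<union> J \<in> intervals_in E \<longrightarrow> F (I \<union> J) = F I + F J)"

text \<open>
  \<^const>\<open>tagged_partial_division_of\<close> also admits degenerate boxes, which are excluded here.
  Two members of a partition with the same interval are equal, because a non-degenerate interval
  overlaps itself; a set of pairs therefore loses nothing against a finite family.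
\<close>

definition hk_partition_in ::
    "((real ^ 'n) \<times> (real ^ 'n) set) set \<Rightarrow> (real ^ 'n) set \<Rightarrow> bool" where
  "hk_partition_in \<pi> E \<longleftrightarrow>
     \<pi> tagged_partial_division_of E \<and> (\<forall>(t, I)\<in>\<pi>. I \<in> intervals_in E)"

definition gauge_on :: "(real ^ 'n) set \<Rightarrow> (real ^ 'n \<Rightarrow> real) \<Rightarrow> bool" where
  "gauge_on Z \<delta> \<longleftrightarrow> (\<forall>t\<in>Z. 0 < \<delta> t)"

definition tagged_in :: "(real ^ 'n) set \<Rightarrow> ((real ^ 'n) \<times> (real ^ 'n) set) set \<Rightarrow> bool" where
  "tagged_in Z \<pi> \<longleftrightarrow> (\<forall>(t, I)\<in>\<pi>. t \<in> Z)"

definition fine_partition ::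
    "(real ^ 'n \<Rightarrow> real) \<Rightarrow> ((real ^ 'n) \<times> (real ^ 'n) set) set \<Rightarrow> bool" where
  "fine_partition \<delta> \<pi> \<longleftrightarrow> (\<forall>(t, I)\<in>\<pi>. I \<subseteq> max_ball t (\<delta> t))"

text \<open>
  The Henstock-Kurzweil integral on a box is \<^const>\<open>has_integral\<close> from the library. Its values
  depend only on the integrand on the box, so no restriction of \<open>v\<close> to \<open>J\<close> is needed.
\<close>

definition hk_integrable_with_primitive ::
    "(real ^ 'n) set \<Rightarrow> (real ^ 'n \<Rightarrow> 'x::banach) \<Rightarrow> ((real ^ 'n) set \<Rightarrow> 'x) \<Rightarrow> bool" where
  "hk_integrable_with_primitive J v V \<longleftrightarrow>
     v integrable_on J \<and> (\<forall>I\<in>intervals_in J. (v has_integral V I) I)"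

definition locally_hk_integrable_with_primitive ::
    "(real ^ 'n) set \<Rightarrow> (real ^ 'n \<Rightarrow> 'x::banach) \<Rightarrow> ((real ^ 'n) set \<Rightarrow> 'x) \<Rightarrow> bool" where
  "locally_hk_integrable_with_primitive W v V \<longleftrightarrow>
     additive_interval_function W V \<and>
     (\<forall>J\<in>intervals_in W. hk_integrable_with_primitive J v V)"

text \<open>
  The divisions of \<open>interior E\<close>. The intervals are only required to lie in \<open>E\<close>; that they
  lie in \<open>interior E\<close> follows from the union. Sequences are indexed from 0.
\<close>

definition divisions_of_interior :: "(real ^ 'n) set \<Rightarrow> (nat \<Rightarrow> (real ^ 'n) set) set" where
  "divisions_of_interior E =
     {C. (\<forall>k. C k \<in> intervals_in E) \<and> (\<forall>k l. k \<noteq> l \<longrightarrow> nonoverlapping (C k) (C l)) \<and>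
         interior E = (\<Union>k. C k)}"

text \<open>
  The index set of the series over \<open>k\<close> with \<open>\<bar>I \<inter> C k\<bar> > 0\<close>. For these \<open>k\<close> the box \<open>I \<inter> C k\<close>
  is non-degenerate. Such series are read as unordered sums: unconditional convergence is
  \<^const>\<open>summable_on\<close>, the value is \<^const>\<open>infsum\<close>.
\<close>

definition overlap_indices :: "(real ^ 'n) set \<Rightarrow> (nat \<Rightarrow> (real ^ 'n) set) \<Rightarrow> nat set" where
  "overlap_indices I C = {k. measure lebesgue (I \<inter> C k) > 0}"

definition hake_function ::
    "(real ^ 'n) set \<Rightarrow> ((real ^ 'n) set \<Rightarrow> 'x::banach) \<Rightarrow> bool" where
  "hake_function E F \<longleftrightarrow>
     additive_interval_function E F \<and>
     (\<forall>C\<in>divisions_of_interior E.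
        (\<forall>I\<in>intervals_in UNIV. (\<lambda>k. F (I \<inter> C k)) summable_on overlap_indices I C) \<and>
        (\<forall>I\<in>intervals_in E. F I = (\<Sum>\<^sub>\<infinity>k\<in>overlap_indices I C. F (I \<inter> C k))))"

definition hk_negligible_variation_over ::
    "(real ^ 'n) set \<Rightarrow> ((real ^ 'n) set \<Rightarrow> 'x::banach) \<Rightarrow> (real ^ 'n) set \<Rightarrow> bool" where
  "hk_negligible_variation_over E F Z \<longleftrightarrow>
     (\<forall>\<epsilon>>0. \<exists>\<delta>. gauge_on Z \<delta> \<and>
        (\<forall>\<pi>. hk_partition_in \<pi> UNIV \<and> tagged_in Z \<pi> \<and> fine_partition \<delta> \<pi> \<longrightarrow>
           (\<forall>C\<in>divisions_of_interior E.
              (\<forall>(t, I)\<in>\<pi>. (\<lambda>k. F (I \<inter> C k)) summable_on overlap_indices I C) \<and>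
              norm (\<Sum>(t, I)\<in>\<pi>. \<Sum>\<^sub>\<infinity>k\<in>overlap_indices I C. F (I \<inter> C k)) < \<epsilon>)))"

definition hake_hk_integrable_with_primitive ::
    "(real ^ 'n) set \<Rightarrow> (real ^ 'n \<Rightarrow> 'x::banach) \<Rightarrow> ((real ^ 'n) set \<Rightarrow> 'x) \<Rightarrow> bool" where
  "hake_hk_integrable_with_primitive E f F \<longleftrightarrow>
     additive_interval_function E F \<and>
     (\<forall>\<epsilon>>0. \<exists>\<delta>. gauge_on (interior E) \<delta> \<and>
        (\<forall>\<pi>. hk_partition_in \<pi> (interior E) \<and> fine_partition \<delta> \<pi> \<longrightarrow>
           norm (\<Sum>(t, I)\<in>\<pi>. measure lebesgue I *\<^sub>R f t - F I) < \<epsilon>)) \<and>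
     hake_function E F \<and>
     hk_negligible_variation_over E F (- interior E)"

end

theory Submission
  imports Defs
begin

text \<open>
  Let \<open>g\<close> be \<open>f\<close> on the interior of \<open>G\<close> and \<open>0\<close> elsewhere; it agrees with \<open>h\<close> almost everywhere.
  For a division \<open>C\<close> put \<open>S I = (\<Sum>\<^sub>\<infinity>k. F (I \<inter> C k))\<close>; this is additive in \<open>I\<close>. In a fine
  partition of a box, the tags in the interior of \<open>G\<close> are controlled by the Henstock condition on
  \<open>f\<close>, where \<open>S = F\<close>, and the remaining tags by negligible variation, so \<open>S\<close> is the primitive of
  \<open>g\<close>. Conversely, the Saks-Henstock lemma for \<open>g\<close> on the whole space, applied to partitions
  tagged in the interior and outside of it, gives the Henstock condition and negligible variation.
\<close>

section \<open>Nondegenerate boxes and balls of the maximum norm\<close>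

lemma content_pos_iff_cart:
  fixes a b :: "real ^ 'n"
  shows "0 < measure lborel (cbox a b) \<longleftrightarrow> (\<forall>j. a $ j < b $ j)"
  unfolding content_pos_lt_eq by (auto simp: Basis_vec_def inner_axis)

text \<open>Positive content does not depend on the endpoints chosen to represent the set, so it
  serves as the test of nondegeneracy for members of a tagged division.\<close>

lemma intervals_in_cbox_iff:
  fixes a b :: "real ^ 'n"
  shows "cbox a b \<in> intervals_in E \<longleftrightarrow> 0 < measure lborel (cbox a b) \<and> cbox a b \<subseteq> E"
proof
  assume "cbox a b \<in> intervals_in E"
  then obtain c d where "cbox a b = cbox c d" "\<forall>j. c $ j < d $ j" "cbox c d \<subseteq> E"
    unfolding intervals_in_def by blast
  then show "0 < measure lborel (cbox a b) \<and> cbox a b \<subseteq> E"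
    using content_pos_iff_cart[of c d] by simp
next
  assume "0 < measure lborel (cbox a b) \<and> cbox a b \<subseteq> E"
  then show "cbox a b \<in> intervals_in E"
    unfolding intervals_in_def content_pos_iff_cart by blast
qed

lemma intervals_inE:
  assumes "I \<in> intervals_in E"
  obtains a b where "I = cbox a b" "\<forall>j. a $ j < b $ j" "cbox a b \<subseteq> E"
  using assms unfolding intervals_in_def by blast

lemma intervals_in_mono: "A \<subseteq> B \<Longrightarrow> intervals_in A \<subseteq> intervals_in B"
  unfolding intervals_in_def by blast

lemma max_ball_mono: "r \<le> s \<Longrightarrow> max_ball t r \<subseteq> max_ball t s"
  unfolding max_ball_def by auto

text \<open>Translates a positive radius function into a gauge in the sense of
  \<open>has_integral\<close>, where any open neighbourhood of the tag is allowed.\<close>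

lemma gauge_max_ball:
  fixes \<delta> :: "real ^ 'n \<Rightarrow> real"
  assumes "\<And>t. 0 < \<delta> t"
  shows "gauge (\<lambda>t. max_ball t (\<delta> t))"
  unfolding gauge_def
proof (intro allI conjI)
  fix t
  show "t \<in> max_ball t (\<delta> t)"
    using assms by (simp add: max_ball_def infnorm_0)
  show "open (max_ball t (\<delta> t))"
    unfolding max_ball_def by (intro open_Collect_less continuous_intros)
qed

text \<open>The Euclidean norm is at most \<open>sqrt (DIM(real ^ 'n))\<close> times the maximum
  norm, so dividing a Euclidean radius by this factor suffices.\<close>

lemma open_contains_max_ball:
  fixes t :: "real ^ 'n"
  assumes "open S" "t \<in> S"
  obtains r where "0 < r" "max_ball t r \<subseteq> S"
proof -
  obtain e where e: "e > 0" "ball t e \<subseteq> S"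
    using assms open_contains_ball by blast
  define d where "d = sqrt (DIM(real ^ 'n))"
  have d: "d > 0" unfolding d_def by simp
  have "max_ball t (e / d) \<subseteq> ball t e"
  proof
    fix x assume "x \<in> max_ball t (e / d)"
    then have "d * infnorm (x - t) < e"
      using d by (simp add: max_ball_def field_simps)
    moreover have "norm (x - t) \<le> d * infnorm (x - t)"
      unfolding d_def by (rule norm_le_infnorm)
    ultimately show "x \<in> ball t e"
      by (simp add: dist_norm norm_minus_commute)
  qed
  with e d that[of "e / d"] show ?thesis by auto
qed

lemma tagged_partial_division_of_bigger:
  assumes "\<pi> tagged_partial_division_of S" "\<And>t I. (t, I) \<in> \<pi> \<Longrightarrow> I \<subseteq> T"
  shows "\<pi> tagged_partial_division_of T"
  using assms unfolding tagged_partial_division_of_def by blast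

section \<open>The Saks-Henstock lemma on the whole space\<close>

text \<open>The tags are sorted by their maximum norm; the \<open>n\<close>-th class is a partial partition of the
  cube of radius \<open>n\<close>, to which the Saks-Henstock lemma applies with error \<open>\<epsilon> / 2 ^ (n + 2)\<close>.\<close>

lemma Henstock_lemma_UNIV:
  fixes g :: "real ^ 'n \<Rightarrow> 'x::banach"
  assumes int: "\<And>a b. g integrable_on cbox a b" and "\<epsilon> > 0"
  obtains \<delta> where "\<And>t. 0 < \<delta> t"
    "\<And>\<pi>. hk_partition_in \<pi> UNIV \<Longrightarrow> fine_partition \<delta> \<pi> \<Longrightarrow>
       norm (\<Sum>(t, I)\<in>\<pi>. measure lebesgue I *\<^sub>R g t - integral I g) < \<epsilon>"
proof -
  define B where "B n = cbox (\<chi> i. - real n) (\<chi> i::'n. real n)" for n :: nat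
  \<comment> \<open>These errors sum to \<epsilon> / 2; the slack turns the non-strict Saks-Henstock
    bounds into a strict one.\<close>
  define e where "e n = \<epsilon> / 4 * (1 / 2) ^ n" for n :: nat
  have e: "e n > 0" for n using \<open>\<epsilon> > 0\<close> by (simp add: e_def)
  have "\<exists>\<gamma>. gauge \<gamma> \<and> (\<forall>p. p tagged_partial_division_of B n \<and> \<gamma> fine p \<longrightarrow>
          norm (\<Sum>(t, I)\<in>p. measure lborel I *\<^sub>R g t - integral I g) \<le> e n)" for n
  proof -
    have gB: "g integrable_on B n" unfolding B_def by (rule int)
    obtain \<gamma> where "gauge \<gamma>" and \<gamma>: "\<And>p. p tagged_division_of B n \<Longrightarrow> \<gamma> fine p \<Longrightarrow>
        norm ((\<Sum>(t, I)\<in>p. measure lborel I *\<^sub>R g t) - integral (B n) g) < e n"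
      using integrable_integral[OF gB, unfolded B_def has_integral, rule_format, OF e[of n]]
      unfolding B_def[symmetric] by metis
    have "norm (\<Sum>(t, I)\<in>p. measure lborel I *\<^sub>R g t - integral I g) \<le> e n"
      if "p tagged_partial_division_of B n" "\<gamma> fine p" for p
      by (rule Henstock_lemma_part1[OF gB[unfolded B_def] e \<open>gauge \<gamma>\<close> \<gamma>[unfolded B_def]
            that(1)[unfolded B_def] that(2)])
    with \<open>gauge \<gamma>\<close> show ?thesis by blast
  qed
  then obtain \<gamma> where \<gamma>: "\<And>n. gauge (\<gamma> n)"
    and small: "\<And>n p. p tagged_partial_division_of B n \<Longrightarrow> \<gamma> n fine p \<Longrightarrow>
      norm (\<Sum>(t, I)\<in>p. measure lborel I *\<^sub>R g t - integral I g) \<le> e n"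
    using choice[of "\<lambda>n \<gamma>. gauge \<gamma> \<and> (\<forall>p. p tagged_partial_division_of B n \<and> \<gamma> fine p \<longrightarrow>
      norm (\<Sum>(t, I)\<in>p. measure lborel I *\<^sub>R g t - integral I g) \<le> e n)"] by blast
  \<comment> \<open>The extra 1 makes room in the cube \<open>B (m t)\<close> for the unit ball
    around \<open>t\<close>, not only for \<open>t\<close> itself.\<close>
  define m where "m t = nat \<lceil>infnorm t\<rceil> + 1" for t :: "real ^ 'n"
  have mB: "max_ball t 1 \<subseteq> B (m t)" for t
  proof
    fix x assume "x \<in> max_ball t 1"
    then have "infnorm (x - t) < 1" by (simp add: max_ball_def)
    moreover have "\<bar>infnorm x - infnorm t\<bar> \<le> infnorm (x - t)" by (rule absdiff_infnorm)
    moreover have "infnorm t \<le> real (nat \<lceil>infnorm t\<rceil>)" by linarith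
    ultimately have "infnorm x \<le> real (m t)" by (simp add: m_def)
    then have "\<bar>x $ i\<bar> \<le> real (m t)" for i
      using component_le_infnorm_cart[of x i] by linarith
    then show "x \<in> B (m t)"
      by (simp add: B_def mem_box_cart abs_le_iff minus_le_iff)
  qed
  \<comment> \<open>A radius of at most 1 keeps a fine interval in the cube belonging to its tag,
    and the inclusion makes each class of tags fine for the gauge of its cube.\<close>
  have "\<exists>r. 0 < r \<and> r \<le> 1 \<and> max_ball t r \<subseteq> \<gamma> (m t) t" for t
  proof -
    have "open (\<gamma> (m t) t)" "t \<in> \<gamma> (m t) t" using \<gamma>[of "m t"] by (auto simp: gauge_def)
    then obtain r where "0 < r" "max_ball t r \<subseteq> \<gamma> (m t) t"
      by (rule open_contains_max_ball)
    then show ?thesis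
      using max_ball_mono[of "min r 1" r t] by (intro exI[of _ "min r 1"]) auto
  qed
  then obtain \<delta> where \<delta>: "\<And>t. 0 < \<delta> t" "\<And>t. \<delta> t \<le> 1" "\<And>t. max_ball t (\<delta> t) \<subseteq> \<gamma> (m t) t"
    by metis
  show thesis
  proof (rule that[OF \<delta>(1)])
    fix \<pi> :: "((real ^ 'n) \<times> (real ^ 'n) set) set"
    assume \<pi>: "hk_partition_in \<pi> UNIV" "fine_partition \<delta> \<pi>"
    let ?T = "\<lambda>x. measure lebesgue (snd x) *\<^sub>R g (fst x) - integral (snd x) g"
    define \<pi>' where "\<pi>' n = {x \<in> \<pi>. m (fst x) = n}" for n
    have part: "\<pi> tagged_partial_division_of UNIV"
      and cb: "\<And>t I. (t, I) \<in> \<pi> \<Longrightarrow> I \<in> intervals_in UNIV"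
      using \<pi>(1) unfolding hk_partition_in_def by auto
    have fin: "finite \<pi>" using part by (rule tagged_partial_division_ofD(1))
    have sub: "I \<subseteq> max_ball t (\<delta> t)" if "(t, I) \<in> \<pi>" for t I
      using \<pi>(2) that by (auto simp: fine_partition_def)
    have bound: "norm (sum ?T (\<pi>' n)) \<le> e n" for n
    proof -
      have 1: "\<pi>' n tagged_partial_division_of B n"
      proof (rule tagged_partial_division_of_bigger[OF tagged_partial_division_subset[OF part]])
        show "\<pi>' n \<subseteq> \<pi>" by (auto simp: \<pi>'_def)
        fix t I assume "(t, I) \<in> \<pi>' n"
        then show "I \<subseteq> B n"
          using sub[of t I] max_ball_mono[OF \<delta>(2), of t t] mB[of t] by (auto simp: \<pi>'_def)
      qed
      have 2: "\<gamma> n fine \<pi>' n"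
        unfolding fine_def \<pi>'_def using sub \<delta>(3) by fastforce
      have "sum ?T (\<pi>' n) = (\<Sum>(t, I)\<in>\<pi>' n. measure lborel I *\<^sub>R g t - integral I g)"
      proof (rule sum.cong[OF refl])
        fix x assume "x \<in> \<pi>' n"
        then have "snd x \<in> intervals_in UNIV"
          using cb[of "fst x" "snd x"] by (simp add: \<pi>'_def)
        then show "?T x = (case x of (t, I) \<Rightarrow> measure lborel I *\<^sub>R g t - integral I g)"
          by (auto simp: split_beta elim!: intervals_inE)
      qed
      with small[OF 1 2] show ?thesis by simp
    qed
    \<comment> \<open>Only finitely many classes occur, and each contributes one term of the
      geometric series.\<close>
    let ?N = "(\<lambda>x. m (fst x)) ` \<pi>"
    have "sum ?T \<pi> = (\<Sum>n\<in>?N. sum ?T (\<pi>' n))"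
      unfolding \<pi>'_def by (rule sum.image_gen[OF fin])
    then have "norm (sum ?T \<pi>) \<le> (\<Sum>n\<in>?N. e n)"
      using bound by (simp add: sum_norm_le)
    also have "\<dots> = \<epsilon> / 4 * (\<Sum>n\<in>?N. (1 / 2) ^ n)"
      by (simp add: e_def sum_distrib_left)
    also have "(\<Sum>n\<in>?N. (1 / 2) ^ n) \<le> (\<Sum>n. (1 / 2 :: real) ^ n)"
      using fin by (intro sum_le_suminf) auto
    then have "\<epsilon> / 4 * (\<Sum>n\<in>?N. (1 / 2) ^ n) \<le> \<epsilon> / 4 * 2"
      using \<open>\<epsilon> > 0\<close> by (intro mult_left_mono) (auto simp: suminf_geometric)
    also have "\<dots> < \<epsilon>" using \<open>\<epsilon> > 0\<close> by simp
    finally show "norm (\<Sum>(t, I)\<in>\<pi>. measure lebesgue I *\<^sub>R g t - integral I g) < \<epsilon>"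
      by (simp add: split_beta)
  qed
qed

section \<open>Existence of divisions\<close>

text \<open>The covering lemma, applied in every integer unit cube, gives countably many boxes
  inside the open set; together they are enumerated as one sequence. The forward direction of the
  theorem needs such a division to obtain an integral at all.\<close>

lemma divisions_of_interior_nonempty:
  fixes G :: "(real ^ 'n) set"
  assumes "interior G \<noteq> {}"
  shows "divisions_of_interior G \<noteq> {}"
proof -
  define S where "S = interior G"
  have S: "open S" "S \<noteq> {}" "S \<subseteq> G"
    using assms interior_subset by (auto simp: S_def)
  \<comment> \<open>The covering lemma works inside one bounded box, hence the decomposition of the
    space into unit cubes.\<close>
  define Q where "Q z = cbox (\<chi> i. real_of_int (z $ i)) (\<chi> i. real_of_int (z $ i) + 1)"
    for z :: "int ^ 'n"
  \<comment> \<open>The covering lemma places each of its boxes in \<open>g x\<close> for some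
    \<open>x\<close> of \<open>S\<close> in that box, so this gauge forces the boxes into
    \<open>S\<close>.\<close>
  define g where "g x = (if x \<in> S then S else UNIV)" for x
  have g: "gauge g" using S(1) by (auto simp: gauge_def g_def)
  have "\<exists>\<D>. countable \<D> \<and> \<Union>\<D> \<subseteq> Q z \<and>
      (\<forall>K\<in>\<D>. interior K \<noteq> {} \<and> (\<exists>c d. K = cbox c d)) \<and>
      pairwise (\<lambda>A B. interior A \<inter> interior B = {}) \<D> \<and>
      (\<forall>K\<in>\<D>. K \<subseteq> S) \<and> S \<inter> Q z \<subseteq> \<Union>\<D>" for z
  proof -
    have "box (\<chi> i. real_of_int (z $ i)) (\<chi> i. real_of_int (z $ i) + 1) \<noteq> {}"
      by (simp add: interval_ne_empty_cart)
    moreover have "S \<inter> Q z \<subseteq> cbox (\<chi> i. real_of_int (z $ i)) (\<chi> i. real_of_int (z $ i) + 1)"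
      unfolding Q_def by blast
    ultimately obtain \<D> where D: "countable \<D>" "\<Union>\<D> \<subseteq> Q z"
      "\<And>K. K \<in> \<D> \<Longrightarrow> interior K \<noteq> {} \<and> (\<exists>c d. K = cbox c d)"
      "pairwise (\<lambda>A B. interior A \<inter> interior B = {}) \<D>"
      "\<And>K. K \<in> \<D> \<Longrightarrow> \<exists>x \<in> (S \<inter> Q z) \<inter> K. K \<subseteq> g x" "S \<inter> Q z \<subseteq> \<Union>\<D>"
      unfolding Q_def[symmetric] using covering_lemma[OF _ _ g] Q_def by metis
    have "\<forall>K\<in>\<D>. K \<subseteq> S"
      using D(5) by (fastforce simp: g_def)
    with D show ?thesis by (intro exI[of _ \<D>]) simp
  qed
  then obtain \<D> where cnt: "\<And>z. countable (\<D> z)" and sub: "\<And>z. \<Union>(\<D> z) \<subseteq> Q z"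
    and box: "\<And>z K. K \<in> \<D> z \<Longrightarrow> interior K \<noteq> {} \<and> (\<exists>c d. K = cbox c d)"
    and pw: "\<And>z. pairwise (\<lambda>A B. interior A \<inter> interior B = {}) (\<D> z)"
    and subS: "\<And>z K. K \<in> \<D> z \<Longrightarrow> K \<subseteq> S" and cover: "\<And>z. S \<inter> Q z \<subseteq> \<Union>(\<D> z)"
    by metis
  define \<E> where "\<E> = (\<Union>z. \<D> z)"
  have UE: "\<Union>\<E> = S"
  proof
    show "\<Union>\<E> \<subseteq> S" using subS by (auto simp: \<E>_def)
    show "S \<subseteq> \<Union>\<E>"
    proof
      fix x assume "x \<in> S"
      moreover have "x \<in> Q (\<chi> i. \<lfloor>x $ i\<rfloor>)"
        by (simp add: Q_def mem_box_cart)
      ultimately have "x \<in> \<Union>(\<D> (\<chi> i. \<lfloor>x $ i\<rfloor>))" by (intro subsetD[OF cover] IntI)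
      then show "x \<in> \<Union>\<E>" unfolding \<E>_def by blast
    qed
  qed
  have sep: "interior A \<inter> interior B = {}" if "A \<in> \<E>" "B \<in> \<E>" "A \<noteq> B" for A B
  proof (rule ccontr)
    assume "interior A \<inter> interior B \<noteq> {}"
    then obtain x where x: "x \<in> interior A" "x \<in> interior B" by blast
    obtain z w where zw: "A \<in> \<D> z" "B \<in> \<D> w" using \<open>A \<in> \<E>\<close> \<open>B \<in> \<E>\<close> by (auto simp: \<E>_def)
    \<comment> \<open>The corner of a unit cube is the coordinatewise floor of any of its interior
      points, so boxes that share an interior point come from the same cube.\<close>
    have "x \<in> interior (Q z)" "x \<in> interior (Q w)"
      using x zw sub interior_mono by (metis Sup_upper subset_iff)+
    then have "x $ i > of_int (z $ i)" "x $ i < of_int (z $ i) + 1"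
      "x $ i > of_int (w $ i)" "x $ i < of_int (w $ i) + 1" for i
      by (auto simp: Q_def interior_cbox mem_box_cart)
    then have "z $ i = w $ i" for i by (smt (verit, best) floor_unique less_imp_le)
    then have "z = w" by (simp add: vec_eq_iff)
    with zw pw[of z] \<open>A \<noteq> B\<close> x show False by (auto simp: pairwise_def)
  qed
  have "countable \<E>" unfolding \<E>_def using cnt by auto
  \<comment> \<open>Distinct indices of a division carry non-overlapping intervals, so the
    enumeration must be injective, which needs infinitely many boxes. Finitely many would make
    \<open>S\<close> compact: a nonempty, bounded, open and closed set in a connected unbounded
    space.\<close>
  moreover have "infinite \<E>"
  proof
    assume "finite \<E>"
    then have "compact (\<Union>\<E>)"
      using box compact_cbox by (intro compact_Union) (auto simp: \<E>_def, metis compact_cbox)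
    then have "closed S" "bounded S" using UE compact_imp_closed compact_imp_bounded by auto
    with S show False using clopen[of S] not_bounded_UNIV by auto
  qed
  ultimately have bij: "bij_betw (from_nat_into \<E>) UNIV \<E>"
    by (rule bij_betw_from_nat_into)
  define C where "C = from_nat_into \<E>"
  have CE: "C k \<in> \<E>" for k using bij by (auto simp: C_def bij_betw_def)
  have "C k \<in> intervals_in G" for k
  proof -
    obtain z where z: "C k \<in> \<D> z" using CE[of k] by (auto simp: \<E>_def)
    then obtain c d where cd: "C k = cbox c d" "interior (cbox c d) \<noteq> {}" using box by metis
    then have "\<forall>j. c $ j < d $ j" by (simp add: interior_cbox interval_ne_empty_cart)
    moreover have "cbox c d \<subseteq> G" using cd(1) subS[OF z] S(3) by blast
    ultimately show ?thesis unfolding cd(1) intervals_in_def by blast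
  qed
  moreover have "nonoverlapping (C k) (C l)" if "k \<noteq> l" for k l
    unfolding nonoverlapping_def
    by (rule sep[OF CE CE]) (use bij that in \<open>auto simp: C_def bij_betw_def inj_on_def\<close>)
  moreover have "interior G = (\<Union>k. C k)"
    using bij UE by (simp add: C_def S_def bij_betw_def)
  ultimately show ?thesis unfolding divisions_of_interior_def by blast
qed

section \<open>Additivity of the series over a division\<close>

lemma has_sum_sum:
  fixes f :: "'i \<Rightarrow> 'a \<Rightarrow> 'b::topological_comm_monoid_add"
  assumes "\<And>i. i \<in> S \<Longrightarrow> (f i has_sum a i) A"
  shows "((\<lambda>x. \<Sum>i\<in>S. f i x) has_sum (\<Sum>i\<in>S. a i)) A"
  using assms by (induction S rule: infinite_finite_induct) (auto intro: has_sum_add)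

text \<open>The value 0 on null sets turns a series over \<open>overlap_indices I C\<close> into one
  over all indices, the same for every \<open>I\<close>, so that finitely many series can be added
  termwise. It also overrides the arbitrary values of \<open>F\<close> on degenerate boxes.\<close>

definition fat_part :: "((real ^ 'n) set \<Rightarrow> 'x::real_normed_vector) \<Rightarrow> (real ^ 'n) set \<Rightarrow> 'x" where
  "fat_part F A = (if 0 < measure lebesgue A then F A else 0)"

lemma fat_part_null: "measure lborel (cbox a b) = 0 \<Longrightarrow> fat_part F (cbox a b) = 0"
  by (simp add: fat_part_def)

text \<open>A cut through the inside of a nondegenerate box gives two non-overlapping intervals, to
  which additivity of \<open>F\<close> applies. Any other cut leaves the box whole and adds a
  degenerate piece of value 0.\<close>

lemma fat_part_split:
  fixes F :: "(real ^ 'n) set \<Rightarrow> 'x::real_normed_vector" and c :: real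
  assumes F: "additive_interval_function E F" and sub: "cbox u v \<subseteq> E"
  shows "fat_part F (cbox u v) =
    fat_part F (cbox u v \<inter> {x. x $ i \<le> c}) + fat_part F (cbox u v \<inter> {x. c \<le> x $ i})"
proof -
  \<comment> \<open>\<open>w\<close> is the upper corner of the lower piece, \<open>z\<close> the
    lower corner of the upper piece.\<close>
  define w z where "w = (\<chi> j. if j = i then min (v $ i) c else v $ j)"
    and "z = (\<chi> j. if j = i then max (u $ i) c else u $ j)"
  have L: "cbox u v \<inter> {x. x $ i \<le> c} = cbox u w" and R: "cbox u v \<inter> {x. c \<le> x $ i} = cbox z v"
    using interval_split_cart[where a = u and b = v and k = i and c = c] by (simp_all add: w_def z_def interval_cbox_cart)
  have Lsub: "cbox u w \<subseteq> cbox u v" and Rsub: "cbox z v \<subseteq> cbox u v"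
    using L R by auto
  show ?thesis
  proof (cases "0 < measure lborel (cbox u v)")
    case False
    then have "measure lborel (cbox u v) = 0" by (simp add: zero_less_measure_iff)
    moreover from this have "measure lborel (cbox u w) = 0" "measure lborel (cbox z v) = 0"
      using Lsub Rsub content_0_subset by blast+
    ultimately show ?thesis unfolding L R by (simp add: fat_part_null)
  next
    case True
    then have uv: "\<And>j. u $ j < v $ j" by (simp add: content_pos_iff_cart)
    consider "c \<le> u $ i" | "v $ i \<le> c" | "u $ i < c" "c < v $ i" by linarith
    then show ?thesis
    proof cases
      case 1
      then have "\<not> (\<forall>j. u $ j < w $ j)" by (auto simp: w_def not_less intro!: exI[of _ i])
      then have "measure lborel (cbox u w) = 0"
        using content_pos_iff_cart[of u w] by (metis zero_less_measure_iff)
      moreover have "z = u" using 1 by (auto simp: z_def vec_eq_iff)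
      ultimately show ?thesis unfolding L R by (simp add: fat_part_null)
    next
      case 2
      then have "\<not> (\<forall>j. z $ j < v $ j)" by (auto simp: z_def not_less intro!: exI[of _ i])
      then have "measure lborel (cbox z v) = 0"
        using content_pos_iff_cart[of z v] by (metis zero_less_measure_iff)
      moreover have "w = v" using 2 by (auto simp: w_def vec_eq_iff)
      ultimately show ?thesis unfolding L R by (simp add: fat_part_null)
    next
      case 3
      have cL: "0 < measure lborel (cbox u w)" and cR: "0 < measure lborel (cbox z v)"
        unfolding content_pos_iff_cart using 3 uv by (auto simp: w_def z_def)
      have U: "cbox u w \<union> cbox z v = cbox u v"
        unfolding L[symmetric] R[symmetric] by auto
      have "x $ i < c" if "x \<in> box u w" for x
        using that by (auto simp: mem_box_cart w_def dest!: spec[of _ i])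
      moreover have "c < x $ i" if "x \<in> box z v" for x
        using that by (auto simp: mem_box_cart z_def dest!: spec[of _ i])
      ultimately have "nonoverlapping (cbox u w) (cbox z v)"
        unfolding nonoverlapping_def interior_cbox by fastforce
      moreover have "cbox u w \<in> intervals_in E" "cbox z v \<in> intervals_in E"
        "cbox u w \<union> cbox z v \<in> intervals_in E"
        unfolding U intervals_in_cbox_iff using cL cR True Lsub Rsub sub by auto
      ultimately have "F (cbox u v) = F (cbox u w) + F (cbox z v)"
        using F U unfolding additive_interval_function_def by metis
      then show ?thesis unfolding L R using cL cR True by (simp add: fat_part_def)
    qed
  qed
qed

text \<open>\<open>operative\<close> is the form of additivity that extends to all tagged divisions
  of a box. Intersecting with \<open>D\<close> keeps every piece inside \<open>E\<close>, even when
  the box itself sticks out of \<open>E\<close>.\<close>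

lemma operative_fat_part:
  fixes F :: "(real ^ 'n) set \<Rightarrow> 'x::real_normed_vector"
  assumes F: "additive_interval_function E F" and D: "D \<in> intervals_in E"
  shows "operative (+) 0 (\<lambda>I. fat_part F (I \<inter> D))"
proof (intro operative.intro operative_axioms.intro)
  show "comm_monoid_set (+) (0 :: 'x)" by (rule sum.comm_monoid_set_axioms)
  obtain c d where cd: "D = cbox c d" "cbox c d \<subseteq> E" using D by (rule intervals_inE)
  show "fat_part F (cbox a b \<inter> D) = 0" if "box a b = {}" for a b
  proof -
    have "measure lborel (cbox a b) = 0" using that by (simp add: content_eq_0_interior interior_cbox)
    moreover obtain u v where uv: "cbox a b \<inter> D = cbox u v"
      unfolding cd Int_interval by blast
    ultimately have "measure lborel (cbox u v) = 0"
      using content_0_subset by blast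
    then show ?thesis unfolding uv by (rule fat_part_null)
  qed
  show "fat_part F (cbox a b \<inter> D) = fat_part F (cbox a b \<inter> {x. x \<bullet> k \<le> r} \<inter> D) +
      fat_part F (cbox a b \<inter> {x. r \<le> x \<bullet> k} \<inter> D)" if k_Basis: "k \<in> Basis" for a b r k
  proof -
    obtain i where k: "k = axis i 1" using k_Basis by (auto simp: Basis_vec_def)
    obtain u v where uv: "cbox a b \<inter> D = cbox u v"
      unfolding cd Int_interval by blast
    then have "cbox u v \<subseteq> E" using cd by blast
    from fat_part_split[OF F this, of i r] show ?thesis
      unfolding k inner_axis uv[symmetric] by (simp add: Int_ac)
  qed
qed

lemma fat_part_has_sum_iff:
  "((\<lambda>k. fat_part F (I \<inter> C k)) has_sum s) UNIV \<longleftrightarrow>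
   ((\<lambda>k. F (I \<inter> C k)) has_sum s) (overlap_indices I C)"
  by (rule has_sum_cong_neutral) (auto simp: overlap_indices_def fat_part_def)

text \<open>A tagged division is finite, so its series may be added term by term. For each
  \<open>k\<close>, additivity on the fixed interval \<open>C k\<close> reassembles the pieces, and
  uniqueness of sums does the rest.\<close>

lemma sum_tagged_division_fat_part:
  fixes F :: "(real ^ 'n) set \<Rightarrow> 'x::real_normed_vector"
  assumes F: "additive_interval_function E F" and C: "\<And>k. C k \<in> intervals_in E"
    and S: "\<And>a b. ((\<lambda>k. fat_part F (cbox a b \<inter> C k)) has_sum S (cbox a b)) UNIV"
    and D: "\<D> tagged_division_of cbox a b"
  shows "(\<Sum>(t, I)\<in>\<D>. S I) = S (cbox a b)"
proof (rule has_sum_unique)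
  have "((\<lambda>k. fat_part F (snd x \<inter> C k)) has_sum S (snd x)) UNIV" if "x \<in> \<D>" for x
    using S tagged_division_ofD(4)[OF D, of "fst x" "snd x"] that by fastforce
  then have "((\<lambda>k. \<Sum>x\<in>\<D>. fat_part F (snd x \<inter> C k)) has_sum (\<Sum>x\<in>\<D>. S (snd x))) UNIV"
    by (rule has_sum_sum)
  moreover have "(\<Sum>x\<in>\<D>. fat_part F (snd x \<inter> C k)) = fat_part F (cbox a b \<inter> C k)" for k
    using operative.tagged_division[OF operative_fat_part[OF F C] D]
    unfolding sum_def[symmetric] by (simp add: split_beta)
  ultimately show "((\<lambda>k. fat_part F (cbox a b \<inter> C k)) has_sum (\<Sum>(t, I)\<in>\<D>. S I)) UNIV"
    by (simp add: split_beta)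
  show "((\<lambda>k. fat_part F (cbox a b \<inter> C k)) has_sum S (cbox a b)) UNIV" by (rule S)
qed

section \<open>From the Hake-Henstock-Kurzweil integral to the Henstock-Kurzweil integral\<close>

text \<open>Common refinements of divisions need not be divisions. That the sums do not depend on \<open>C\<close>
  comes instead from the uniqueness of the integral that they all represent.\<close>

lemma hake_hk_integrable_has_integral:
  fixes f :: "real ^ 'n \<Rightarrow> 'x::banach"
  assumes hake: "hake_hk_integrable_with_primitive G f F" and C: "C \<in> divisions_of_interior G"
  shows "((\<lambda>t. if t \<in> interior G then f t else 0) has_integral
    (\<Sum>\<^sub>\<infinity>k\<in>overlap_indices (cbox a b) C. F (cbox a b \<inter> C k))) (cbox a b)"
proof -
  define S where "S I = (\<Sum>\<^sub>\<infinity>k\<in>overlap_indices I C. F (I \<inter> C k))" for I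
  define g where "g t = (if t \<in> interior G then f t else 0)" for t
  have F: "additive_interval_function G F" and hf: "hake_function G F"
    and negl: "hk_negligible_variation_over G F (- interior G)"
    using hake by (auto simp: hake_hk_integrable_with_primitive_def)
  have CG: "C k \<in> intervals_in G" for k using C by (auto simp: divisions_of_interior_def)
  \<comment> \<open>The tagged divisions behind \<open>has_integral\<close> may contain degenerate
    boxes; \<open>S\<close> vanishes on them, as the content does.\<close>
  have null: "overlap_indices (cbox u v) C = {}" if "measure lborel (cbox u v) = 0" for u v
  proof -
    have "measure lborel (cbox u v \<inter> C k) = 0" for k
    proof -
      obtain c d where "C k = cbox c d" using CG[of k] by (rule intervals_inE)
      then obtain p q where "cbox u v \<inter> C k = cbox p q" using Int_interval by blast
      with that content_0_subset show ?thesis by (metis Int_lower1)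
    qed
    moreover have "cbox u v \<inter> C k \<in> sets borel" for k
      using CG[of k] by (auto elim!: intervals_inE)
    ultimately show ?thesis by (simp add: overlap_indices_def)
  qed
  have S: "((\<lambda>k. fat_part F (cbox u v \<inter> C k)) has_sum S (cbox u v)) UNIV" for u v
  proof (cases "measure lborel (cbox u v) = 0")
    case True
    then show ?thesis unfolding fat_part_has_sum_iff S_def by (simp add: null)
  next
    case False
    then have "cbox u v \<in> intervals_in UNIV"
      by (simp add: intervals_in_cbox_iff zero_less_measure_iff)
    then show ?thesis
      unfolding fat_part_has_sum_iff S_def using hf C
      by (simp add: hake_function_def)
  qed
  have "(g has_integral S (cbox a b)) (cbox a b)"
    unfolding has_integral
  proof (intro allI impI)
    fix e :: real assume "e > 0"
    then have e2: "e / 2 > 0" by simp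
    obtain \<delta>1 where \<delta>1: "gauge_on (interior G) \<delta>1"
      "\<And>\<pi>. hk_partition_in \<pi> (interior G) \<Longrightarrow> fine_partition \<delta>1 \<pi> \<Longrightarrow>
         norm (\<Sum>(t, I)\<in>\<pi>. measure lebesgue I *\<^sub>R f t - F I) < e / 2"
      using hake e2 unfolding hake_hk_integrable_with_primitive_def by meson
    obtain \<delta>2 where \<delta>2: "gauge_on (- interior G) \<delta>2"
      "\<And>\<pi>. hk_partition_in \<pi> UNIV \<Longrightarrow> tagged_in (- interior G) \<pi> \<Longrightarrow> fine_partition \<delta>2 \<pi> \<Longrightarrow>
         norm (\<Sum>(t, I)\<in>\<pi>. S I) < e / 2"
      using negl e2 C unfolding hk_negligible_variation_over_def S_def by meson
    \<comment> \<open>At an interior tag the radius also confines the interval to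
      \<open>interior G\<close>, because the Henstock condition on \<open>f\<close> speaks only of
      partitions in that set.\<close>
    have "\<exists>r. 0 < r \<and> (if t \<in> interior G then r \<le> \<delta>1 t \<and> max_ball t r \<subseteq> interior G else r = \<delta>2 t)"
      for t
    proof (cases "t \<in> interior G")
      case True
      then obtain r where "0 < r" "max_ball t r \<subseteq> interior G"
        using open_contains_max_ball[OF open_interior] by metis
      with True \<delta>1(1) max_ball_mono[of "min r (\<delta>1 t)" r t] show ?thesis
        by (intro exI[of _ "min r (\<delta>1 t)"]) (auto simp: gauge_on_def)
    next
      case False
      with \<delta>2(1) show ?thesis by (auto simp: gauge_on_def)
    qed
    then obtain \<delta> where \<delta>: "\<And>t. 0 < \<delta> t"
      "\<And>t. t \<in> interior G \<Longrightarrow> \<delta> t \<le> \<delta>1 t" "\<And>t. t \<in> interior G \<Longrightarrow> max_ball t (\<delta> t) \<subseteq> interior G"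
      "\<And>t. t \<notin> interior G \<Longrightarrow> \<delta> t = \<delta>2 t"
      by metis
    have "norm ((\<Sum>(t, I)\<in>\<D>. measure lborel I *\<^sub>R g t) - S (cbox a b)) < e"
      if D: "\<D> tagged_division_of cbox a b" and fine: "(\<lambda>t. max_ball t (\<delta> t)) fine \<D>" for \<D>
    proof -
      have fin: "finite \<D>" using D by blast
      have part: "\<D> tagged_partial_division_of cbox a b"
        using D by (simp add: tagged_division_of_def)
      have ball: "I \<subseteq> max_ball t (\<delta> t)" if "(t, I) \<in> \<D>" for t I
        using fine that by (auto simp: fine_def)
      \<comment> \<open>Degenerate members go into neither \<open>P\<close> nor \<open>N\<close>,
        since \<open>hk_partition_in\<close> excludes them.\<close>
      define P where "P = {x \<in> \<D>. 0 < measure lborel (snd x) \<and> fst x \<in> interior G}"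
      define N where "N = {x \<in> \<D>. 0 < measure lborel (snd x) \<and> fst x \<notin> interior G}"
      have iv: "I \<in> intervals_in T" if "(t, I) \<in> \<D>" "0 < measure lborel I" "I \<subseteq> T" for t I T
        using tagged_division_ofD(4)[OF D that(1)] that(2,3) by (auto simp: intervals_in_cbox_iff)
      have Psub: "I \<subseteq> interior G" if "(t, I) \<in> P" for t I
        using that ball[of t I] \<delta>(3)[of t] by (auto simp: P_def)
      have "hk_partition_in P (interior G)"
        unfolding hk_partition_in_def
      proof
        show "P tagged_partial_division_of interior G"
          by (rule tagged_partial_division_of_bigger[OF tagged_partial_division_subset[OF part]])
            (use Psub in \<open>auto simp: P_def\<close>)
        show "\<forall>(t, I)\<in>P. I \<in> intervals_in (interior G)"
          using iv Psub by (auto simp: P_def)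
      qed
      moreover have "fine_partition \<delta>1 P"
        unfolding fine_partition_def P_def using ball max_ball_mono[OF \<delta>(2)] by fastforce
      ultimately have 1: "norm (\<Sum>(t, I)\<in>P. measure lebesgue I *\<^sub>R f t - F I) < e / 2"
        by (rule \<delta>1(2))
      have "hk_partition_in N UNIV"
        unfolding hk_partition_in_def
      proof
        show "N tagged_partial_division_of UNIV"
          by (rule tagged_partial_division_of_bigger[OF tagged_partial_division_subset[OF part]])
            (auto simp: N_def)
        show "\<forall>(t, I)\<in>N. I \<in> intervals_in UNIV"
          using iv by (auto simp: N_def)
      qed
      moreover have "tagged_in (- interior G) N" by (auto simp: tagged_in_def N_def)
      moreover have "fine_partition \<delta>2 N"
        unfolding fine_partition_def N_def using ball \<delta>(4) by fastforce
      ultimately have 2: "norm (\<Sum>(t, I)\<in>N. S I) < e / 2"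
        by (rule \<delta>2(2))
      let ?T = "\<lambda>(t, I). measure lborel I *\<^sub>R g t - S I"
      \<comment> \<open>Additivity distributes \<open>S (cbox a b)\<close> over the division, so the
        error becomes a sum over single members.\<close>
      have "(\<Sum>(t, I)\<in>\<D>. measure lborel I *\<^sub>R g t) - S (cbox a b) = sum ?T \<D>"
        unfolding sum_tagged_division_fat_part[OF F CG S D, symmetric]
        by (simp add: sum_subtractf split_beta)
      also have "\<dots> = sum ?T (P \<union> N)"
      proof (rule sum.mono_neutral_right[OF fin])
        show "\<forall>x\<in>\<D> - (P \<union> N). ?T x = 0"
        proof
          fix x assume x: "x \<in> \<D> - (P \<union> N)"
          obtain t I where tI: "x = (t, I)" by force
          obtain u v where uv: "I = cbox u v" using tagged_division_ofD(4)[OF D] x tI by blast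
          have "measure lborel I = 0" using x by (auto simp: tI P_def N_def zero_less_measure_iff)
          then show "?T x = 0" by (simp add: tI uv S_def null)
        qed
      qed (auto simp: P_def N_def)
      also have "\<dots> = sum ?T P + sum ?T N"
        by (rule sum.union_disjoint) (use fin in \<open>auto simp: P_def N_def\<close>)
      \<comment> \<open>The intervals of \<open>P\<close> lie in \<open>G\<close>, where the Hake
        property turns \<open>S\<close> into \<open>F\<close>.\<close>
      also have "sum ?T P = (\<Sum>(t, I)\<in>P. measure lebesgue I *\<^sub>R f t - F I)"
      proof (rule sum.cong[OF refl], clarify)
        fix t I assume tI: "(t, I) \<in> P"
        then have "I \<in> intervals_in G"
          using iv[of t I G] Psub interior_subset by (force simp: P_def)
        moreover from this have "F I = S I"
          using hf C by (simp add: hake_function_def S_def)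
        ultimately show "measure lborel I *\<^sub>R g t - S I = measure lebesgue I *\<^sub>R f t - F I"
          using tI by (auto simp: P_def g_def elim!: intervals_inE)
      qed
      also have "sum ?T N = - (\<Sum>(t, I)\<in>N. S I)"
        unfolding sum_negf[symmetric] by (rule sum.cong[OF refl]) (auto simp: N_def g_def)
      finally show ?thesis
        using 1 2 norm_triangle_ineq4[of "\<Sum>(t, I)\<in>P. measure lebesgue I *\<^sub>R f t - F I"
            "\<Sum>(t, I)\<in>N. S I"] by simp
    qed
    then show "\<exists>\<gamma>. gauge \<gamma> \<and> (\<forall>\<D>. \<D> tagged_division_of cbox a b \<and> \<gamma> fine \<D> \<longrightarrow>
        norm ((\<Sum>(t, I)\<in>\<D>. measure lborel I *\<^sub>R g t) - S (cbox a b)) < e)"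
      using gauge_max_ball[of \<delta>] \<delta>(1) by blast
  qed
  then show ?thesis by (simp add: g_def[abs_def] S_def)
qed

section \<open>The equivalence\<close>

text \<open>Non-overlapping boxes meet only in points of their frontiers, and these are
  negligible.\<close>

lemma additive_integral:
  fixes h :: "real ^ 'n \<Rightarrow> 'x::banach"
  assumes "\<And>I. I \<in> intervals_in UNIV \<Longrightarrow> h integrable_on I"
  shows "additive_interval_function UNIV (\<lambda>I. integral I h)"
  unfolding additive_interval_function_def
proof (intro ballI impI)
  fix I J :: "(real ^ 'n) set"
  assume I: "I \<in> intervals_in UNIV" and J: "J \<in> intervals_in UNIV"
    and IJ: "nonoverlapping I J \<and> I \<union> J \<in> intervals_in UNIV"
  obtain a b c d where ab: "I = cbox a b" "J = cbox c d"
    using I J by (metis intervals_inE)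
  have "I \<inter> J \<subseteq> (I - interior I) \<union> (J - interior J)"
    using IJ by (auto simp: nonoverlapping_def)
  moreover have "negligible (I - interior I)" "negligible (J - interior J)"
    by (simp_all add: ab interior_cbox negligible_frontier_interval)
  ultimately have "negligible (I \<inter> J)" by (meson negligible_Un negligible_subset)
  then show "integral (I \<union> J) h = integral I h + integral J h"
    using assms I J by (intro integral_Un)
qed

theorem theorem2p9:
  fixes G :: "(real ^ 'n) set"
    and f h :: "real ^ 'n \<Rightarrow> 'x::banach"
    and F :: "(real ^ 'n) set \<Rightarrow> 'x"
  assumes "interior G \<noteq> {}"
    and "G - interior G \<in> null_sets lebesgue"
    and "additive_interval_function G F"
    and "\<And>t. h t = (if t \<in> G then f t else 0)"
  shows "hake_hk_integrable_with_primitive G f F \<longleftrightarrow>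
    (\<exists>H. locally_hk_integrable_with_primitive UNIV h H \<and>
         (\<forall>I\<in>intervals_in G. H I = F I) \<and>
         (\<forall>C\<in>divisions_of_interior G. \<forall>I\<in>intervals_in UNIV.
            ((\<lambda>k. F (I \<inter> C k)) has_sum H I) (overlap_indices I C)))"
proof -
  define g where "g t = (if t \<in> interior G then f t else 0)" for t
  have neg: "negligible (G - interior G)"
    using assms(2) by (simp add: negligible_iff_null_sets)
  \<comment> \<open>Both directions can thus work with \<open>g\<close>, which vanishes at every tag
    outside the interior, whereas \<open>h\<close> need not vanish on
    \<open>G - interior G\<close>.\<close>
  have gh: "(g has_integral y) I \<longleftrightarrow> (h has_integral y) I" for y I
    by (rule has_integral_spike_eq[OF neg]) (use interior_subset in \<open>auto simp: g_def assms(4)\<close>)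
  show ?thesis
  proof
    assume L: "hake_hk_integrable_with_primitive G f F"
    then have hf: "hake_function G F" by (simp add: hake_hk_integrable_with_primitive_def)
    have hint: "(h has_integral (\<Sum>\<^sub>\<infinity>k\<in>overlap_indices I C. F (I \<inter> C k))) I"
      if "C \<in> divisions_of_interior G" "I \<in> intervals_in UNIV" for C I
    proof -
      obtain a b where "I = cbox a b" using \<open>I \<in> intervals_in UNIV\<close> by (rule intervals_inE)
      then show ?thesis
        using hake_hk_integrable_has_integral[OF L that(1)]
        by (simp add: gh[symmetric] g_def[abs_def])
    qed
    obtain C0 where C0: "C0 \<in> divisions_of_interior G"
      using divisions_of_interior_nonempty[OF assms(1)] by blast
    have int: "h integrable_on I" if "I \<in> intervals_in UNIV" for I
      using hint[OF C0 that] by blast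
    \<comment> \<open>Taking the integral as definition makes \<open>H\<close> independent of the
      division; \<open>HC\<close> then identifies it with the sum over any division.\<close>
    define H where "H I = integral I h" for I
    have H: "(h has_integral H I) I" if "I \<in> intervals_in UNIV" for I
      unfolding H_def by (rule integrable_integral[OF int[OF that]])
    have HC: "H I = (\<Sum>\<^sub>\<infinity>k\<in>overlap_indices I C. F (I \<inter> C k))"
      if "C \<in> divisions_of_interior G" "I \<in> intervals_in UNIV" for C I
      using has_integral_unique[OF H[OF that(2)] hint[OF that]] .
    have univ: "I \<in> intervals_in UNIV" if "I \<in> intervals_in E" for I E :: "(real ^ 'n) set"
      using that intervals_in_mono[OF subset_UNIV] by blast
    show "\<exists>H. locally_hk_integrable_with_primitive UNIV h H \<and>
         (\<forall>I\<in>intervals_in G. H I = F I) \<and>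
         (\<forall>C\<in>divisions_of_interior G. \<forall>I\<in>intervals_in UNIV.
            ((\<lambda>k. F (I \<inter> C k)) has_sum H I) (overlap_indices I C))"
    proof (intro exI[of _ H] conjI ballI)
      show "locally_hk_integrable_with_primitive UNIV h H"
        unfolding locally_hk_integrable_with_primitive_def hk_integrable_with_primitive_def
        using additive_integral[OF int] int H univ by (simp add: H_def[abs_def])
      show "H I = F I" if "I \<in> intervals_in G" for I
        using HC[OF C0 univ[OF that]] hf C0 that by (simp add: hake_function_def)
      show "((\<lambda>k. F (I \<inter> C k)) has_sum H I) (overlap_indices I C)"
        if "C \<in> divisions_of_interior G" "I \<in> intervals_in UNIV" for C I
        using hf that HC[OF that] by (simp add: hake_function_def)
    qed
  next
    assume "\<exists>H. locally_hk_integrable_with_primitive UNIV h H \<and>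
         (\<forall>I\<in>intervals_in G. H I = F I) \<and>
         (\<forall>C\<in>divisions_of_interior G. \<forall>I\<in>intervals_in UNIV.
            ((\<lambda>k. F (I \<inter> C k)) has_sum H I) (overlap_indices I C))"
    then obtain H where loc: "locally_hk_integrable_with_primitive UNIV h H"
      and HF: "\<And>I. I \<in> intervals_in G \<Longrightarrow> H I = F I"
      and HS: "\<And>C I. C \<in> divisions_of_interior G \<Longrightarrow> I \<in> intervals_in UNIV \<Longrightarrow>
            ((\<lambda>k. F (I \<inter> C k)) has_sum H I) (overlap_indices I C)"
      by blast
    have univ: "I \<in> intervals_in UNIV" if "I \<in> intervals_in E" for I E :: "(real ^ 'n) set"
      using that intervals_in_mono[OF subset_UNIV] by blast
    have self: "I \<in> intervals_in I" if "I \<in> intervals_in E" for I E :: "(real ^ 'n) set"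
      using that by (auto simp: intervals_in_def)
    have gH: "(g has_integral H I) I" if "I \<in> intervals_in UNIV" for I
      unfolding gh using loc that self[OF that]
      by (auto simp: locally_hk_integrable_with_primitive_def hk_integrable_with_primitive_def)
    \<comment> \<open>\<open>Henstock_lemma_UNIV\<close> asks for integrability on every box, and
      \<open>gH\<close> covers only the nondegenerate ones.\<close>
    have gint: "g integrable_on cbox a b" for a b
    proof (cases "measure lborel (cbox a b) = 0")
      case True
      then show ?thesis by (rule integrable_on_null)
    next
      case False
      then have "cbox a b \<in> intervals_in UNIV"
        by (simp add: intervals_in_cbox_iff zero_less_measure_iff)
      with gH show ?thesis by blast
    qed
    have Hsum: "(\<Sum>\<^sub>\<infinity>k\<in>overlap_indices I C. F (I \<inter> C k)) = H I"
      if "C \<in> divisions_of_interior G" "I \<in> intervals_in UNIV" for C I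
      using HS[OF that] by (rule infsumI)
    have henstock: "\<exists>\<delta>. (\<forall>t. 0 < \<delta> t) \<and> (\<forall>\<pi>. hk_partition_in \<pi> UNIV \<and> fine_partition \<delta> \<pi> \<longrightarrow>
        norm (\<Sum>(t, I)\<in>\<pi>. measure lebesgue I *\<^sub>R g t - H I) < \<epsilon>)" if eps: "\<epsilon> > 0" for \<epsilon>
    proof -
      obtain \<delta> where \<delta>: "\<And>t. 0 < \<delta> t" "\<And>\<pi>. hk_partition_in \<pi> UNIV \<Longrightarrow> fine_partition \<delta> \<pi> \<Longrightarrow>
         norm (\<Sum>(t, I)\<in>\<pi>. measure lebesgue I *\<^sub>R g t - integral I g) < \<epsilon>"
        using Henstock_lemma_UNIV[OF gint eps] by blast
      have "(\<Sum>(t, I)\<in>\<pi>. measure lebesgue I *\<^sub>R g t - H I) =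
          (\<Sum>(t, I)\<in>\<pi>. measure lebesgue I *\<^sub>R g t - integral I g)" if "hk_partition_in \<pi> UNIV" for \<pi>
        using that by (intro sum.cong) (auto simp: hk_partition_in_def integral_unique[OF gH])
      with \<delta> show ?thesis by (intro exI[of _ \<delta>]) simp
    qed
    have a: "\<exists>\<delta>. gauge_on (interior G) \<delta> \<and>
        (\<forall>\<pi>. hk_partition_in \<pi> (interior G) \<and> fine_partition \<delta> \<pi> \<longrightarrow>
           norm (\<Sum>(t, I)\<in>\<pi>. measure lebesgue I *\<^sub>R f t - F I) < \<epsilon>)" if eps: "\<epsilon> > 0" for \<epsilon>
    proof -
      obtain \<delta> where \<delta>: "\<And>t. 0 < \<delta> t" "\<And>\<pi>. hk_partition_in \<pi> UNIV \<Longrightarrow> fine_partition \<delta> \<pi> \<Longrightarrow>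
         norm (\<Sum>(t, I)\<in>\<pi>. measure lebesgue I *\<^sub>R g t - H I) < \<epsilon>"
        using henstock[OF eps] by blast
      have "norm (\<Sum>(t, I)\<in>\<pi>. measure lebesgue I *\<^sub>R f t - F I) < \<epsilon>"
        if \<pi>: "hk_partition_in \<pi> (interior G)" "fine_partition \<delta> \<pi>" for \<pi>
      proof -
        have part: "\<pi> tagged_partial_division_of interior G"
          and iv: "\<And>t I. (t, I) \<in> \<pi> \<Longrightarrow> I \<in> intervals_in (interior G)"
          using \<pi>(1) by (auto simp: hk_partition_in_def)
        have "hk_partition_in \<pi> UNIV"
          unfolding hk_partition_in_def
          using tagged_partial_division_of_bigger[OF part, of UNIV] univ iv by blast
        moreover have "(\<Sum>(t, I)\<in>\<pi>. measure lebesgue I *\<^sub>R f t - F I) =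
            (\<Sum>(t, I)\<in>\<pi>. measure lebesgue I *\<^sub>R g t - H I)"
        proof (rule sum.cong[OF refl], clarify)
          fix t I assume tI: "(t, I) \<in> \<pi>"
          have "t \<in> interior G"
            using tagged_partial_division_ofD(2,3)[OF part tI] by blast
          moreover have "I \<in> intervals_in G"
            using iv[OF tI] intervals_in_mono[OF interior_subset] by blast
          ultimately show "measure lebesgue I *\<^sub>R f t - F I = measure lebesgue I *\<^sub>R g t - H I"
            using HF by (simp add: g_def)
        qed
        ultimately show ?thesis using \<delta>(2) \<pi>(2) by simp
      qed
      with \<delta>(1) show ?thesis unfolding gauge_on_def by blast
    qed
    have b: "hake_function G F"
      unfolding hake_function_def
    proof (intro conjI ballI)
      show "additive_interval_function G F" by (rule assms(3))
      show "(\<lambda>k. F (I \<inter> C k)) summable_on overlap_indices I C"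
        if "C \<in> divisions_of_interior G" "I \<in> intervals_in UNIV" for C I
        using HS[OF that] by (rule has_sum_imp_summable)
      show "F I = (\<Sum>\<^sub>\<infinity>k\<in>overlap_indices I C. F (I \<inter> C k))"
        if "C \<in> divisions_of_interior G" "I \<in> intervals_in G" for C I
        using Hsum[OF that(1) univ[OF that(2)]] HF[OF that(2)] by simp
    qed
    have c: "hk_negligible_variation_over G F (- interior G)"
      unfolding hk_negligible_variation_over_def
    proof (intro allI impI)
      fix \<epsilon> :: real assume "\<epsilon> > 0"
      \<comment> \<open>Negligible variation demands a gauge chosen before \<open>C\<close>; this is
        possible because \<open>H\<close> is the same for all divisions.\<close>
      obtain \<delta> where \<delta>: "\<And>t. 0 < \<delta> t" "\<And>\<pi>. hk_partition_in \<pi> UNIV \<Longrightarrow> fine_partition \<delta> \<pi> \<Longrightarrow>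
         norm (\<Sum>(t, I)\<in>\<pi>. measure lebesgue I *\<^sub>R g t - H I) < \<epsilon>"
        using henstock[OF \<open>\<epsilon> > 0\<close>] by blast
      have "(\<forall>(t, I)\<in>\<pi>. (\<lambda>k. F (I \<inter> C k)) summable_on overlap_indices I C) \<and>
          norm (\<Sum>(t, I)\<in>\<pi>. \<Sum>\<^sub>\<infinity>k\<in>overlap_indices I C. F (I \<inter> C k)) < \<epsilon>"
        if \<pi>: "hk_partition_in \<pi> UNIV" "tagged_in (- interior G) \<pi>" "fine_partition \<delta> \<pi>"
          and C: "C \<in> divisions_of_interior G" for \<pi> C
      proof
        have iv: "I \<in> intervals_in UNIV" if "(t, I) \<in> \<pi>" for t I
          using \<pi>(1) that by (auto simp: hk_partition_in_def)
        then show "\<forall>(t, I)\<in>\<pi>. (\<lambda>k. F (I \<inter> C k)) summable_on overlap_indices I C"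
          using HS[OF C] has_sum_imp_summable by blast
        \<comment> \<open>All tags lie outside the interior, where \<open>g\<close> is 0, so the
          Henstock sum is minus the sum of the \<open>H I\<close>, each of which is a series over
          \<open>C\<close>.\<close>
        have "(\<Sum>(t, I)\<in>\<pi>. \<Sum>\<^sub>\<infinity>k\<in>overlap_indices I C. F (I \<inter> C k)) =
            - (\<Sum>(t, I)\<in>\<pi>. measure lebesgue I *\<^sub>R g t - H I)"
          unfolding sum_negf[symmetric]
          using \<pi>(2) by (intro sum.cong) (auto simp: tagged_in_def g_def Hsum[OF C iv])
        then show "norm (\<Sum>(t, I)\<in>\<pi>. \<Sum>\<^sub>\<infinity>k\<in>overlap_indices I C. F (I \<inter> C k)) < \<epsilon>"
          using \<delta>(2)[OF \<pi>(1,3)] by simp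
      qed
      with \<delta>(1) show "\<exists>\<delta>. gauge_on (- interior G) \<delta> \<and>
        (\<forall>\<pi>. hk_partition_in \<pi> UNIV \<and> tagged_in (- interior G) \<pi> \<and> fine_partition \<delta> \<pi> \<longrightarrow>
           (\<forall>C\<in>divisions_of_interior G.
              (\<forall>(t, I)\<in>\<pi>. (\<lambda>k. F (I \<inter> C k)) summable_on overlap_indices I C) \<and>
              norm (\<Sum>(t, I)\<in>\<pi>. \<Sum>\<^sub>\<infinity>k\<in>overlap_indices I C. F (I \<inter> C k)) < \<epsilon>))"
        unfolding gauge_on_def by blast
    qed
    show "hake_hk_integrable_with_primitive G f F"
      unfolding hake_hk_integrable_with_primitive_def
      using assms(3) a b c by blast
  qed
qed

end
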